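(* Let $(b_n)_{n\ge1}\in\ell^2$ with $b_1\ne0$ and $\|(b_n)\|_2=r<1$, and suppose that the power series $\sum_{n\ge1}|b_n|^2z^n$ has radius of convergence $1$. Let $f(z)=(b_1z,b_2z^2,b_3z^3,\dots)$ for $z\in\overline{\mathbb{D}}$ and $V=f(\mathbb{D})$. Then $\overline V=f(\overline{\mathbb{D}})$ is the common zero locus in $\mathbb{B}_\infty$ of the polynomials $\{b_nz_1^n-b_1^nz_n:n\ge2\}$; that is, \[ \overline V=\{(z_1,z_2,\dots)\in\mathbb{B}_\infty:\ b_nz_1^n-b_1^nz_n=0\ \text{ for all } n\ge2\}. \]
   Context: $\mathbb{D}$ is the open unit disc, $\mathbb{B}_\infty$ is the open unit ball of $\ell^2$, and $\overline V$ is the norm closure of $V$ in $\ell^2$. *)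

theory Defs
  imports "HOL-Analysis.Analysis"
begin

text \<open>
  Complex square-summable sequences indexed by \<open>n \<ge> 1\<close>. The condition \<open>x 0 = 0\<close>
  only discards the unused index \<open>0\<close>, so that coordinate \<open>n\<close> is \<open>z\<^sub>n\<close>.
\<close>

typedef ell2 = "{x :: nat \<Rightarrow> complex. x 0 = 0 \<and> summable (\<lambda>n. (cmod (x n))\<^sup>2)}"
  morphisms coord Abs_ell2
proof
  show "(\<lambda>_. 0) \<in> {x :: nat \<Rightarrow> complex. x 0 = 0 \<and> summable (\<lambda>n. (cmod (x n))\<^sup>2)}"
    by simp
qed

lemma coord_0 [simp]: "coord x 0 = 0"
  using coord[of x] by simp

lemma summable_coord: "summable (\<lambda>n. (cmod (coord x n))\<^sup>2)"
  using coord[of x] by simp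

lemma coord_Abs_ell2:
  assumes "x 0 = 0" "summable (\<lambda>n. (cmod (x n))\<^sup>2)"
  shows "coord (Abs_ell2 x) = x"
  using assms by (simp add: Abs_ell2_inverse)

lemma ell2_eqI: "(\<And>n. coord x n = coord y n) \<Longrightarrow> x = y"
  by (metis coord_inject ext)

lemma summable_cmod_add:
  fixes x y :: "nat \<Rightarrow> complex"
  assumes "summable (\<lambda>n. (cmod (x n))\<^sup>2)" "summable (\<lambda>n. (cmod (y n))\<^sup>2)"
  shows "summable (\<lambda>n. (cmod (x n + y n))\<^sup>2)"
proof (rule summable_comparison_test')
  show "summable (\<lambda>n. 2 * (cmod (x n))\<^sup>2 + 2 * (cmod (y n))\<^sup>2)"
    by (intro summable_add summable_mult assms)
  fix n :: nat
  have "(cmod (x n + y n))\<^sup>2 \<le> (cmod (x n) + cmod (y n))\<^sup>2"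
    by (intro power_mono norm_triangle_ineq norm_ge_zero)
  also have "\<dots> \<le> 2 * (cmod (x n))\<^sup>2 + 2 * (cmod (y n))\<^sup>2"
    using sum_squares_bound[of "cmod (x n)" "cmod (y n)"] by (simp add: power2_sum)
  finally show "norm ((cmod (x n + y n))\<^sup>2) \<le> 2 * (cmod (x n))\<^sup>2 + 2 * (cmod (y n))\<^sup>2"
    by simp
qed

lemma summable_inner_coord: "summable (\<lambda>n. coord x n \<bullet> coord y n)"
proof (rule summable_comparison_test')
  show "summable (\<lambda>n. (cmod (coord x n))\<^sup>2 + (cmod (coord y n))\<^sup>2)"
    by (intro summable_add summable_coord)
  fix n :: nat
  have "\<bar>coord x n \<bullet> coord y n\<bar> \<le> cmod (coord x n) * cmod (coord y n)"
    by (rule Cauchy_Schwarz_ineq2)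
  also have "\<dots> \<le> (cmod (coord x n))\<^sup>2 + (cmod (coord y n))\<^sup>2"
    using sum_squares_bound[of "cmod (coord x n)" "cmod (coord y n)"]
      mult_nonneg_nonneg[OF norm_ge_zero[of "coord x n"] norm_ge_zero[of "coord y n"]]
    by linarith
  finally show "norm (coord x n \<bullet> coord y n) \<le> (cmod (coord x n))\<^sup>2 + (cmod (coord y n))\<^sup>2"
    by simp
qed

text \<open>
  Only the underlying real inner product space is set up (the inner product is the real part
  of the hermitian one); its norm and topology are those of the complex Hilbert space.
\<close>

instantiation ell2 :: real_inner
begin

definition zero_ell2 :: ell2 where "0 = Abs_ell2 (\<lambda>_. 0)"
definition plus_ell2 :: "ell2 \<Rightarrow> ell2 \<Rightarrow> ell2" where
  "x + y = Abs_ell2 (\<lambda>n. coord x n + coord y n)"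
definition scaleR_ell2 :: "real \<Rightarrow> ell2 \<Rightarrow> ell2" where
  "c *\<^sub>R x = Abs_ell2 (\<lambda>n. c *\<^sub>R coord x n)"
definition uminus_ell2 :: "ell2 \<Rightarrow> ell2" where
  "- x = (-1) *\<^sub>R (x :: ell2)"
definition minus_ell2 :: "ell2 \<Rightarrow> ell2 \<Rightarrow> ell2" where
  "x - y = x + (- y :: ell2)"
definition inner_ell2 :: "ell2 \<Rightarrow> ell2 \<Rightarrow> real" where
  "x \<bullet> y = (\<Sum>n. coord x n \<bullet> coord y n)"
definition norm_ell2 :: "ell2 \<Rightarrow> real" where
  "norm x = sqrt (\<Sum>n. (cmod (coord x n))\<^sup>2)"
definition sgn_ell2 :: "ell2 \<Rightarrow> ell2" where
  "sgn x = inverse (norm x) *\<^sub>R (x :: ell2)"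
definition dist_ell2 :: "ell2 \<Rightarrow> ell2 \<Rightarrow> real" where
  "dist x y = norm (x - y :: ell2)"
definition uniformity_ell2 :: "(ell2 \<times> ell2) filter" where
  "uniformity = (INF e\<in>{0 <..}. principal {(x, y :: ell2). dist x y < e})"
definition open_ell2 :: "ell2 set \<Rightarrow> bool" where
  "open U \<longleftrightarrow> (\<forall>x\<in>U. \<forall>\<^sub>F (x', y) in uniformity. x' = (x :: ell2) \<longrightarrow> y \<in> U)"

lemma coord_zero: "coord 0 n = 0"
  unfolding zero_ell2_def by (simp add: coord_Abs_ell2)

lemma coord_add: "coord (x + y) n = coord x n + coord y n"
  unfolding plus_ell2_def by (simp add: coord_Abs_ell2 summable_cmod_add summable_coord)

lemma coord_scaleR: "coord (c *\<^sub>R x) n = c *\<^sub>R coord x n"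
  unfolding scaleR_ell2_def
  by (subst coord_Abs_ell2) (simp_all add: power_mult_distrib summable_mult summable_coord)

lemma coord_uminus: "coord (- x) n = - coord x n"
  unfolding uminus_ell2_def by (simp add: coord_scaleR)

lemma coord_diff: "coord (x - y) n = coord x n - coord y n"
  unfolding minus_ell2_def by (simp add: coord_add coord_uminus)

instance
proof
  fix x y z :: ell2 and a c :: real
  note coord_simps = coord_zero coord_add coord_scaleR coord_uminus coord_diff
  show "x + y + z = x + (y + z)" "x + y = y + x" "0 + x = x" "- x + x = 0" "x - y = x + - y"
    "a *\<^sub>R (x + y) = a *\<^sub>R x + a *\<^sub>R y" "(a + c) *\<^sub>R x = a *\<^sub>R x + c *\<^sub>R x"
    "a *\<^sub>R c *\<^sub>R x = (a * c) *\<^sub>R x" "1 *\<^sub>R x = x"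
    by (rule ell2_eqI; simp add: coord_simps algebra_simps)+
  show "dist x y = norm (x - y)" by (rule dist_ell2_def)
  show "sgn x = inverse (norm x) *\<^sub>R x" by (rule sgn_ell2_def)
  show "uniformity = (INF e\<in>{0 <..}. principal {(x, y :: ell2). dist x y < e})"
    by (rule uniformity_ell2_def)
  show "open U \<longleftrightarrow> (\<forall>x\<in>U. \<forall>\<^sub>F (x', y) in uniformity. x' = x \<longrightarrow> y \<in> U)" for U :: "ell2 set"
    by (rule open_ell2_def)
  show "x \<bullet> y = y \<bullet> x" by (simp add: inner_ell2_def inner_commute)
  show "(x + y) \<bullet> z = x \<bullet> z + y \<bullet> z"
    by (simp add: inner_ell2_def coord_add inner_add_left suminf_add summable_inner_coord)
  show "(a *\<^sub>R x) \<bullet> y = a * (x \<bullet> y)"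
    by (simp add: inner_ell2_def coord_scaleR suminf_mult summable_inner_coord)
  show "0 \<le> x \<bullet> x"
    by (simp add: inner_ell2_def suminf_nonneg summable_inner_coord)
  have "x \<bullet> x = 0 \<longleftrightarrow> (\<forall>n. coord x n \<bullet> coord x n = 0)"
    unfolding inner_ell2_def by (rule suminf_eq_zero_iff[OF summable_inner_coord]) simp
  also have "\<dots> \<longleftrightarrow> x = 0"
    by (auto simp: coord_zero intro: ell2_eqI)
  finally show "x \<bullet> x = 0 \<longleftrightarrow> x = 0" .
  show "norm x = sqrt (x \<bullet> x)"
    by (simp add: norm_ell2_def inner_ell2_def power2_norm_eq_inner)
qed

end

text \<open>
  The coordinate function of \<open>weighted_curve b z\<close> is \<open>n \<mapsto> b\<^sub>n z\<^sup>n\<close>, cf. \<open>coord_weighted_curve\<close>.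
  It is used only for \<open>\<bar>z\<bar> \<le> 1\<close>, where this sequence is square-summable; elsewhere the value
  of \<open>Abs_ell2\<close> may be arbitrary.
\<close>

definition weighted_curve :: "ell2 \<Rightarrow> complex \<Rightarrow> ell2" where
  "weighted_curve b z = Abs_ell2 (\<lambda>n. coord b n * z ^ n)"

lemma coord_weighted_curve:
  assumes "cmod z \<le> 1"
  shows "coord (weighted_curve b z) n = coord b n * z ^ n"
proof -
  have "summable (\<lambda>n. (cmod (coord b n * z ^ n))\<^sup>2)"
  proof (rule summable_comparison_test'[OF summable_coord[of b]])
    fix n :: nat
    have "cmod (coord b n * z ^ n) \<le> cmod (coord b n)"
      using assms by (simp add: norm_mult norm_power mult_left_le power_le_one)
    then show "norm ((cmod (coord b n * z ^ n))\<^sup>2) \<le> (cmod (coord b n))\<^sup>2"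
      by (simp add: power_mono)
  qed
  then show ?thesis
    unfolding weighted_curve_def by (simp add: coord_Abs_ell2)
qed

end

theory Submission
  imports Defs
begin

text \<open>
  Since \<open>b\<close> is square-summable, the curve \<open>f(w) = (b\<^sub>n w\<^sup>n)\<^sub>n\<close> is continuous up to the boundary
  of the disc, as a uniform limit (\<open>continuous_on_weighted_curve\<close>). So \<open>f\<close> maps the closed disc onto a
  compact, hence closed, set, in which the image of the dense open disc is dense.

  On the locus, the equation of index \<open>n\<close> can be solved for \<open>z\<^sub>n\<close> because \<open>b\<^sub>1 \<noteq> 0\<close>: it says
  \<open>z\<^sub>n = b\<^sub>n w\<^sup>n\<close> with \<open>w = z\<^sub>1 / b\<^sub>1\<close>. A point of the locus is therefore a point of the curve as
  soon as \<open>\<bar>w\<bar> \<le> 1\<close>, and here the radius of convergence enters: \<open>z\<close> being square-summable, the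
  series \<open>\<Sum> \<bar>b\<^sub>n\<bar>\<^sup>2 t\<^sup>n\<close> converges at \<open>t = \<bar>w\<bar>\<^sup>2\<close>, so \<open>\<bar>w\<bar>\<^sup>2 \<le> 1\<close>
  (\<open>cmod_le_1_if_coord_eq\<close>). Conversely the curve lies in the unit ball because its
  norm never exceeds that of \<open>b\<close> (\<open>norm_weighted_curve_le\<close>).
\<close>

lemma norm_weighted_curve_le:
  assumes "cmod w \<le> 1"
  shows "norm (weighted_curve b w) \<le> norm b"
proof -
  have "cmod (coord b n * w ^ n) \<le> cmod (coord b n)" for n
    using assms by (simp add: norm_mult norm_power mult_left_le power_le_one)
  then have "(cmod (coord (weighted_curve b w) n))\<^sup>2 \<le> (cmod (coord b n))\<^sup>2" for n
    using assms by (simp add: coord_weighted_curve power_mono)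
  then show ?thesis
    unfolding norm_ell2_def by (intro real_sqrt_le_mono suminf_le summable_coord)
qed

text \<open>
  The distance from \<open>f(w)\<close> to a fixed \<open>f(z)\<close> is the square root of a series of continuous
  functions of \<open>w\<close> dominated by \<open>4 \<bar>b\<^sub>n\<bar>\<^sup>2\<close>. It is thus continuous in \<open>w\<close>, and it vanishes
  at \<open>w = z\<close>.
\<close>

lemma continuous_on_weighted_curve:
  "continuous_on (cball 0 1) (weighted_curve b)"
  unfolding continuous_on_def
proof
  fix z :: complex assume z: "z \<in> cball 0 1"
  let ?g = "\<lambda>n w. (cmod (coord b n * w ^ n - coord b n * z ^ n))\<^sup>2"
  have bound: "norm (?g n w) \<le> 4 * (cmod (coord b n))\<^sup>2" if "w \<in> cball 0 1" for n w
  proof -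
    have "cmod (w ^ n - z ^ n) \<le> cmod w ^ n + cmod z ^ n"
      by (metis norm_triangle_ineq4 norm_power)
    also have "\<dots> \<le> 2"
      using power_le_one[of "cmod w" n] power_le_one[of "cmod z" n] that z by simp
    finally have "cmod (coord b n * w ^ n - coord b n * z ^ n) \<le> cmod (coord b n) * 2"
      by (simp add: mult_left_mono norm_mult flip: right_diff_distrib)
    then have "?g n w \<le> (cmod (coord b n) * 2)\<^sup>2"
      by (intro power_mono norm_ge_zero)
    then show ?thesis by (simp add: power_mult_distrib)
  qed
  have "uniform_limit (cball 0 1) (\<lambda>N w. \<Sum>n<N. ?g n w) (\<lambda>w. \<Sum>n. ?g n w) sequentially"
    by (rule Weierstrass_m_test[OF bound summable_mult[OF summable_coord]])
  then have "continuous_on (cball 0 1) (\<lambda>w. \<Sum>n. ?g n w)"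
    by (rule uniform_limit_theorem[rotated])
       (auto intro!: always_eventually continuous_intros)
  then have "continuous_on (cball 0 1) (\<lambda>w. sqrt (\<Sum>n. ?g n w))"
    by (intro continuous_intros)
  then have "((\<lambda>w. sqrt (\<Sum>n. ?g n w)) \<longlongrightarrow> sqrt (\<Sum>n. ?g n z)) (at z within cball 0 1)"
    using z unfolding continuous_on_def by (rule bspec)
  then have "((\<lambda>w. sqrt (\<Sum>n. ?g n w)) \<longlongrightarrow> 0) (at z within cball 0 1)"
    by simp
  moreover have "\<forall>\<^sub>F w in at z within cball 0 1.
      sqrt (\<Sum>n. ?g n w) = dist (weighted_curve b w) (weighted_curve b z)"
    using z by (auto simp: eventually_at_filter dist_norm norm_ell2_def coord_diff
        coord_weighted_curve intro!: always_eventually)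
  ultimately have "((\<lambda>w. dist (weighted_curve b w) (weighted_curve b z)) \<longlongrightarrow> 0)
      (at z within cball 0 1)"
    by (rule Lim_transform_eventually)
  then show "(weighted_curve b \<longlongrightarrow> weighted_curve b z) (at z within cball 0 1)"
    by (subst tendsto_dist_iff)
qed

text \<open>
  Square-summability of \<open>z\<close> is convergence of \<open>\<Sum> \<bar>b\<^sub>n\<bar>\<^sup>2 t\<^sup>n\<close> at \<open>t = \<bar>w\<bar>\<^sup>2\<close>, so \<open>t\<close> cannot
  exceed the radius of convergence.
\<close>

lemma cmod_le_1_if_coord_eq:
  assumes radius: "conv_radius (\<lambda>n. (cmod (coord b n))\<^sup>2) = 1"
    and eq: "\<And>n. coord z n = coord b n * w ^ n"
  shows "cmod w \<le> 1"
proof -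
  have "summable (\<lambda>n. (cmod (coord b n))\<^sup>2 * ((cmod w)\<^sup>2) ^ n)"
    using summable_coord[of z]
    by (simp add: eq norm_mult norm_power power_mult_distrib mult.commute flip: power_mult)
  then have "ereal (norm ((cmod w)\<^sup>2)) \<le> conv_radius (\<lambda>n. (cmod (coord b n))\<^sup>2)"
    by (intro conv_radius_geI)
  then have "(cmod w)\<^sup>2 \<le> 1"
    by (simp add: radius)
  then show ?thesis
    by (simp add: power_le_one_iff)
qed

lemma locus_eq_weighted_curve_image:
  assumes b1: "coord b 1 \<noteq> 0" and "norm b < 1"
    and radius: "conv_radius (\<lambda>n. (cmod (coord b n))\<^sup>2) = 1"
  shows "{z \<in> ball 0 1. \<forall>n\<ge>2. coord b n * coord z 1 ^ n - coord b 1 ^ n * coord z n = 0}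
    = weighted_curve b ` cball 0 1" (is "?Z = _")
proof (intro equalityI subsetI)
  fix z assume z: "z \<in> ?Z"
  define w where "w = coord z 1 / coord b 1"
  have eq: "coord z n = coord b n * w ^ n" for n
  proof -
    consider "n = 0" | "n = 1" | "n \<ge> 2" by linarith
    then show ?thesis
    proof cases
      case 3
      then have "coord b n * coord z 1 ^ n - coord b 1 ^ n * coord z n = 0"
        using z by blast
      then show ?thesis
        using b1 by (simp add: w_def field_simps power_divide)
    qed (use b1 in \<open>auto simp: w_def\<close>)
  qed
  have w: "cmod w \<le> 1"
    by (rule cmod_le_1_if_coord_eq[OF radius eq])
  then have "z = weighted_curve b w"
    by (intro ell2_eqI) (simp add: eq coord_weighted_curve)
  with w show "z \<in> weighted_curve b ` cball 0 1"
    by auto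
next
  fix z assume "z \<in> weighted_curve b ` cball 0 1"
  then obtain w where w: "cmod w \<le> 1" and z: "z = weighted_curve b w"
    by auto
  have "norm z < 1"
    using norm_weighted_curve_le[OF w, of b] \<open>norm b < 1\<close> z by simp
  then show "z \<in> ?Z"
    using w by (simp add: z coord_weighted_curve power_mult_distrib)
qed

theorem lemma8p1:
  fixes b :: ell2 and r :: real and f :: "complex \<Rightarrow> ell2" and V :: "ell2 set"
  assumes "coord b 1 \<noteq> 0"
    and "norm b = r" and "r < 1"
    and "conv_radius (\<lambda>n. (cmod (coord b n))\<^sup>2) = 1"
    and "f = weighted_curve b"
    and "V = f ` ball 0 1"
  shows "closure V = f ` cball 0 1 \<and>
    closure V = {z \<in> ball 0 1. \<forall>n\<ge>2. coord b n * coord z 1 ^ n - coord b 1 ^ n * coord z n = 0}"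
proof -
  have cont: "continuous_on (cball 0 1) f"
    using continuous_on_weighted_curve assms by simp
  have "closure V = f ` cball 0 1"
  proof
    have "closed (f ` cball 0 1)"
      by (intro compact_imp_closed compact_continuous_image cont compact_cball)
    then show "closure V \<subseteq> f ` cball 0 1"
      using assms by (intro closure_minimal) auto
    have "f ` closure (ball 0 1) \<subseteq> closure V"
      using cont assms by (intro image_closure_subset) (auto simp: closure_subset[THEN subsetD])
    then show "f ` cball 0 1 \<subseteq> closure V"
      by simp
  qed
  then show ?thesis
    using locus_eq_weighted_curve_image[of b] assms by simp
qed

end
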